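(* Let $a,b\in\mathrm{Aut}(T)$ be two contracting automorphisms with finite orbit-signalizers. Then $a$ and $b$ are conjugate in $\mathrm{Aut}(T)$ if and only if they are conjugate in the group $\mathrm{FAut}(T)$ of finite-state automorphisms.
   Context: Let $X=\{1,2,\ldots,d\}$ and let $T$ be the regular rooted $d$-ary tree whose vertices are the words in $X^*$. $\mathrm{Aut}(T)$ is the group of automorphisms of $T$ as a rooted tree, acting on the right ($v^{gh}=(v^g)^h$). For $g\in\mathrm{Aut}(T)$ and $v\in X^*$, the state $g|_v\in\mathrm{Aut}(T)$ is the unique automorphism with $(vw)^g=v^g\,w^{g|_v}$ for all $w\in X^*$. An automorphism $g$ is finite-state if $\{g|_v:v\in X^*\}$ is finite; the finite-state automorphisms form the group $\mathrm{FAut}(T)$. A subgroup $G<\mathrm{Aut}(T)$ is self-similar if $g|_v\in G$ for all $g\in G$, $v\in X^*$. A self-similar subgroup $G$ is contracting if there is a finite set $\mathcal N\subset G$ such that for every $g\in G$ there exists $n\in\mathbb N$ with $g|_v\in\mathcal N$ for all words $v$ of length $\ge n$. An automorphism $f\in\mathrm{Aut}(T)$ is contracting if the self-similar group generated by all states of $f$ is contracting. The orbit-signalizer of $a\in\mathrm{Aut}(T)$ is $\mathrm{OS}(a)=\{a^m|_v: v\in X^*,\ m=|\mathrm{Orb}_a(v)|\}$, where $\mathrm{Orb}_a(v)$ is the orbit of $v$ under $\langle a\rangle$. *)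

theory Defs
  imports "HOL-Algebra.Generated_Groups"
begin

(* The alphabet X is a type 'x; the vertices of the tree T are the words over X, i.e. lists. *)

definition tree_adj :: "'x list \<Rightarrow> 'x list \<Rightarrow> bool" where
  "tree_adj u v \<longleftrightarrow> (\<exists>x. v = u @ [x] \<or> u = v @ [x])"

definition tree_auts :: "('x list \<Rightarrow> 'x list) set" where
  "tree_auts = {g. bij g \<and> g [] = [] \<and> (\<forall>u v. tree_adj (g u) (g v) \<longleftrightarrow> tree_adj u v)}"

(* Right action: the image of v under g is "g v", and the product of g and h applies g first. *)
definition Aut_T :: "('x list \<Rightarrow> 'x list) monoid" where
  "Aut_T = \<lparr>carrier = tree_auts, mult = (\<lambda>g h. h \<circ> g), one = id\<rparr>"

definition state :: "('x list \<Rightarrow> 'x list) \<Rightarrow> 'x list \<Rightarrow> ('x list \<Rightarrow> 'x list)" where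
  "state g v = (THE h. h \<in> carrier Aut_T \<and> (\<forall>w. g (v @ w) = g v @ h w))"

definition states :: "('x list \<Rightarrow> 'x list) \<Rightarrow> ('x list \<Rightarrow> 'x list) set" where
  "states g = {state g v | v. True}"

definition FAut_T :: "('x list \<Rightarrow> 'x list) monoid" where
  "FAut_T = Aut_T\<lparr>carrier := {g \<in> carrier Aut_T. finite (states g)}\<rparr>"

definition self_similar :: "('x list \<Rightarrow> 'x list) set \<Rightarrow> bool" where
  "self_similar G \<longleftrightarrow> subgroup G Aut_T \<and> (\<forall>g\<in>G. \<forall>v. state g v \<in> G)"

definition contracting_group :: "('x list \<Rightarrow> 'x list) set \<Rightarrow> bool" where
  "contracting_group G \<longleftrightarrow> self_similar G \<and>
     (\<exists>N. finite N \<and> N \<subseteq> G \<and>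
       (\<forall>g\<in>G. \<exists>n. \<forall>v. n \<le> length v \<longrightarrow> state g v \<in> N))"

definition contracting_aut :: "('x list \<Rightarrow> 'x list) \<Rightarrow> bool" where
  "contracting_aut f \<longleftrightarrow> f \<in> carrier Aut_T \<and> contracting_group (generate Aut_T (states f))"

definition Orb :: "('x list \<Rightarrow> 'x list) \<Rightarrow> 'x list \<Rightarrow> 'x list set" where
  "Orb a v = {(a [^]\<^bsub>Aut_T\<^esub> k) v | k :: int. True}"

definition orbit_signalizer :: "('x list \<Rightarrow> 'x list) \<Rightarrow> ('x list \<Rightarrow> 'x list) set" where
  "orbit_signalizer a = {state (a [^]\<^bsub>Aut_T\<^esub> card (Orb a v)) v | v. True}"

definition conjugate_in :: "('g, 'm) monoid_scheme \<Rightarrow> 'g \<Rightarrow> 'g \<Rightarrow> bool" where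
  "conjugate_in G a b \<longleftrightarrow> a \<in> carrier G \<and> b \<in> carrier G \<and>
     (\<exists>h\<in>carrier G. b = inv\<^bsub>G\<^esub> h \<otimes>\<^bsub>G\<^esub> a \<otimes>\<^bsub>G\<^esub> h)"


lemma tree_auts_child:
  assumes g: "g \<in> tree_auts"
  shows "\<exists>y. g (v @ [x]) = g v @ [y]"
proof (induction v arbitrary: x rule: rev_induct)
  case Nil
  have "tree_adj [] [x]" by (simp add: tree_adj_def)
  then have "tree_adj (g []) (g [x])" using g unfolding tree_auts_def by blast
  moreover have "g [] = []" using g by (simp add: tree_auts_def)
  ultimately show ?case by (simp add: tree_adj_def)
next
  case (snoc z u)
  obtain y where y: "g (u @ [z]) = g u @ [y]" using snoc by blast
  have inj: "inj g" using g by (simp add: tree_auts_def bij_is_inj)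
  have "tree_adj (u @ [z]) ((u @ [z]) @ [x])" unfolding tree_adj_def by blast
  then have "tree_adj (g (u @ [z])) (g ((u @ [z]) @ [x]))"
    using g unfolding tree_auts_def by blast
  then consider t where "g ((u @ [z]) @ [x]) = g (u @ [z]) @ [t]"
    | t where "g (u @ [z]) = g ((u @ [z]) @ [x]) @ [t]"
    unfolding tree_adj_def by blast
  then show ?case
  proof cases
    case 1
    then show ?thesis by blast
  next
    case 2
    then have "g u = g ((u @ [z]) @ [x])" using y by simp
    then show ?thesis using injD[OF inj, of u "(u @ [z]) @ [x]"] by simp
  qed
qed

lemma tree_auts_append:
  assumes g: "g \<in> tree_auts"
  shows "\<exists>u. length u = length w \<and> g (v @ w) = g v @ u"
proof (induction w rule: rev_induct)
  case Nil
  then show ?case by simp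
next
  case (snoc x w)
  then obtain u where u: "length u = length w" "g (v @ w) = g v @ u" by blast
  obtain y where "g ((v @ w) @ [x]) = g (v @ w) @ [y]" using tree_auts_child[OF g] by blast
  then have "length (u @ [y]) = length (w @ [x]) \<and> g (v @ w @ [x]) = g v @ (u @ [y])"
    using u by simp
  then show ?case by blast
qed

lemma tree_auts_length:
  assumes g: "g \<in> tree_auts"
  shows "length (g v) = length v"
  using tree_auts_append[OF g, where v = "[]" and w = v] g by (auto simp: tree_auts_def)

lemma group_Aut_T: "group Aut_T"
proof (rule groupI)
  fix g h :: "'a list \<Rightarrow> 'a list"
  assume "g \<in> carrier Aut_T" "h \<in> carrier Aut_T"
  then show "g \<otimes>\<^bsub>Aut_T\<^esub> h \<in> carrier Aut_T"
    by (simp add: Aut_T_def tree_auts_def bij_comp)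
next
  fix g :: "'a list \<Rightarrow> 'a list"
  assume "g \<in> carrier Aut_T"
  then have g: "bij g" "g [] = []" "\<And>u v. tree_adj (g u) (g v) \<longleftrightarrow> tree_adj u v"
    by (auto simp: Aut_T_def tree_auts_def)
  have s: "g (inv_into UNIV g u) = u" for u
    using g(1) by (simp add: bij_is_surj surj_f_inv_f)
  have "inv_into UNIV g \<in> carrier Aut_T"
    using g(1,2) g(3)[of "inv_into UNIV g _" "inv_into UNIV g _"] s
    by (auto simp: Aut_T_def tree_auts_def bij_imp_bij_inv bij_is_inj inv_f_eq)
  moreover have "inv_into UNIV g \<otimes>\<^bsub>Aut_T\<^esub> g = \<one>\<^bsub>Aut_T\<^esub>"
    using s by (auto simp: Aut_T_def)
  ultimately show "\<exists>h\<in>carrier Aut_T. h \<otimes>\<^bsub>Aut_T\<^esub> g = \<one>\<^bsub>Aut_T\<^esub>" by blast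
qed (auto simp: Aut_T_def tree_auts_def)

lemma ex1_state:
  assumes "g \<in> carrier Aut_T"
  shows "\<exists>!h. h \<in> carrier Aut_T \<and> (\<forall>w. g (v @ w) = g v @ h w)"
proof -
  have g: "g \<in> tree_auts" using assms by (simp add: Aut_T_def)
  have inj: "inj g" and surj: "surj g"
    using g by (auto simp: tree_auts_def bij_is_inj bij_is_surj)
  define h where "h w = drop (length v) (g (v @ w))" for w
  have h: "g (v @ w) = g v @ h w" for w
    using tree_auts_append[OF g, of w v] by (auto simp: h_def tree_auts_length[OF g])
  have "inj h"
    by (rule injI) (metis h inj injD same_append_eq)
  moreover have "\<exists>w. h w = u" for u
  proof -
    obtain z where z: "g z = g v @ u" using surj by (metis surj_def)
    define p where "p = take (length v) z"
    have l: "length p = length v"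
      using arg_cong[OF z, of length] by (simp add: p_def tree_auts_length[OF g])
    obtain t where "g (p @ drop (length v) z) = g p @ t" using tree_auts_append[OF g] by blast
    then have "g p @ t = g v @ u" using z by (simp add: p_def)
    then have "g p = g v" using l by (simp add: tree_auts_length[OF g])
    then have "p = v" by (rule injD[OF inj])
    then have "z = v @ drop (length v) z" by (metis p_def append_take_drop_id)
    then show ?thesis using h[of "drop (length v) z"] z by auto
  qed
  then have "surj h" by (metis surj_def)
  ultimately have bij: "bij h" by (simp add: bij_def)
  have "h [] = []" using h[of "[]"] by simp
  moreover have "tree_adj (h u) (h w) \<longleftrightarrow> tree_adj u w" for u w
  proof -
    have "tree_adj (h u) (h w) \<longleftrightarrow> tree_adj (g (v @ u)) (g (v @ w))"
      by (simp add: h tree_adj_def)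
    also have "\<dots> \<longleftrightarrow> tree_adj (v @ u) (v @ w)" using g by (simp add: tree_auts_def)
    also have "\<dots> \<longleftrightarrow> tree_adj u w" by (simp add: tree_adj_def)
    finally show ?thesis .
  qed
  ultimately have "h \<in> carrier Aut_T" using bij by (simp add: Aut_T_def tree_auts_def)
  then show ?thesis using h by (intro ex1I[of _ h]) auto
qed

lemma state_in_Aut_T: "g \<in> carrier Aut_T \<Longrightarrow> state g v \<in> carrier Aut_T"
  and state_append: "g \<in> carrier Aut_T \<Longrightarrow> g (v @ w) = g v @ state g v w"
  using theI'[OF ex1_state, of g v] unfolding state_def by blast+

lemma state_eqI:
  assumes "g \<in> carrier Aut_T" "\<And>w. g (v @ w) = g v @ h w"
  shows "state g v = h"
  using state_append[OF assms(1)] assms(2) by (metis ext same_append_eq)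

lemma state_Nil: "g \<in> carrier Aut_T \<Longrightarrow> state g [] = g"
  by (rule state_eqI) (auto simp: Aut_T_def tree_auts_def)

lemma state_state:
  assumes g: "g \<in> carrier Aut_T"
  shows "state (state g v) w = state g (v @ w)"
proof (rule state_eqI)
  show "state g v \<in> carrier Aut_T" by (rule state_in_Aut_T[OF g])
  fix u
  have "g v @ state g v (w @ u) = g v @ state g v w @ state g (v @ w) u"
    using state_append[OF g, of v "w @ u"] state_append[OF g, of "v @ w" u]
      state_append[OF g, of v w] by simp
  then show "state g v (w @ u) = state g v w @ state g (v @ w) u" by simp
qed

lemma state_one: "state \<one>\<^bsub>Aut_T\<^esub> v = \<one>\<^bsub>Aut_T\<^esub>"
  by (rule state_eqI) (auto simp: Aut_T_def tree_auts_def)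

lemma state_mult:
  assumes g: "g \<in> carrier Aut_T" and h: "h \<in> carrier Aut_T"
  shows "state (g \<otimes>\<^bsub>Aut_T\<^esub> h) v = state g v \<otimes>\<^bsub>Aut_T\<^esub> state h (g v)"
proof (rule state_eqI)
  show "g \<otimes>\<^bsub>Aut_T\<^esub> h \<in> carrier Aut_T"
    using g h by (rule monoid.m_closed[OF group.is_monoid[OF group_Aut_T]])
  show "(g \<otimes>\<^bsub>Aut_T\<^esub> h) (v @ w)
      = (g \<otimes>\<^bsub>Aut_T\<^esub> h) v @ (state g v \<otimes>\<^bsub>Aut_T\<^esub> state h (g v)) w" for w
    using state_append[OF g, of v w] state_append[OF h, of "g v"] by (simp add: Aut_T_def)
qed

lemma state_inv:
  assumes g: "g \<in> carrier Aut_T"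
  shows "state (inv\<^bsub>Aut_T\<^esub> g) v = inv\<^bsub>Aut_T\<^esub> (state g ((inv\<^bsub>Aut_T\<^esub> g) v))"
proof -
  interpret group "Aut_T :: ('a list \<Rightarrow> 'a list) monoid" by (rule group_Aut_T)
  have "state (inv\<^bsub>Aut_T\<^esub> g) v \<otimes>\<^bsub>Aut_T\<^esub> state g ((inv\<^bsub>Aut_T\<^esub> g) v) = \<one>\<^bsub>Aut_T\<^esub>"
    using state_mult[of "inv\<^bsub>Aut_T\<^esub> g" g v] g by (simp add: state_one)
  then show ?thesis using g by (metis inv_closed inv_equality state_in_Aut_T)
qed

lemma self_similar_generate_states:
  assumes f: "f \<in> carrier Aut_T"
  shows "self_similar (generate Aut_T (states f))"
proof -
  interpret group "Aut_T :: ('a list \<Rightarrow> 'a list) monoid" by (rule group_Aut_T)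
  have sub: "states f \<subseteq> carrier Aut_T" using f by (auto simp: states_def state_in_Aut_T)
  have st: "state g v \<in> states f" if "g \<in> states f" for g v
    using that f by (auto simp: states_def state_state)
  have "state g v \<in> generate Aut_T (states f)" if "g \<in> generate Aut_T (states f)" for g v
    using that
  proof (induction arbitrary: v rule: generate.induct)
    case one
    then show ?case by (simp add: state_one generate.one)
  next
    case (incl h)
    then show ?case by (simp add: st generate.incl)
  next
    case (inv h)
    then show ?case using sub by (simp add: subset_iff state_inv st generate.inv)
  next
    case (eng g h)
    then show ?case using generate_in_carrier[OF sub] by (simp add: state_mult generate.eng)
  qed
  then show ?thesis using generate_is_subgroup[OF sub] by (simp add: self_similar_def)
qed

lemma subgroup_FAut_T: "subgroup (carrier FAut_T) Aut_T"
proof -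
  interpret group "Aut_T :: ('a list \<Rightarrow> 'a list) monoid" by (rule group_Aut_T)
  show ?thesis
  proof (rule subgroupI)
    show "carrier FAut_T \<subseteq> carrier (Aut_T :: ('a list \<Rightarrow> 'a list) monoid)"
      by (auto simp: FAut_T_def)
    have "\<one>\<^bsub>Aut_T\<^esub> \<in> carrier (FAut_T :: ('a list \<Rightarrow> 'a list) monoid)"
      by (simp add: FAut_T_def states_def state_one)
    then show "carrier (FAut_T :: ('a list \<Rightarrow> 'a list) monoid) \<noteq> {}" by blast
  next
    fix g :: "'a list \<Rightarrow> 'a list" assume "g \<in> carrier FAut_T"
    then have g: "g \<in> carrier Aut_T" "finite (states g)" by (auto simp: FAut_T_def)
    have "states (inv\<^bsub>Aut_T\<^esub> g) \<subseteq> m_inv Aut_T ` states g"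
      using state_inv[OF g(1)] by (auto simp: states_def)
    then show "inv\<^bsub>Aut_T\<^esub> g \<in> carrier FAut_T"
      using g by (simp add: FAut_T_def finite_subset)
  next
    fix g h :: "'a list \<Rightarrow> 'a list" assume "g \<in> carrier FAut_T" "h \<in> carrier FAut_T"
    then have gh: "g \<in> carrier Aut_T" "finite (states g)" "h \<in> carrier Aut_T" "finite (states h)"
      by (auto simp: FAut_T_def)
    have "states (g \<otimes>\<^bsub>Aut_T\<^esub> h) \<subseteq> (\<lambda>(p, q). p \<otimes>\<^bsub>Aut_T\<^esub> q) ` (states g \<times> states h)"
      using state_mult[OF gh(1,3)] by (auto simp: states_def)
    then have "finite (states (g \<otimes>\<^bsub>Aut_T\<^esub> h))"
      by (rule finite_subset) (use gh in simp)
    then show "g \<otimes>\<^bsub>Aut_T\<^esub> h \<in> carrier FAut_T"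
      using gh by (simp add: FAut_T_def)
  qed
qed

lemma group_FAut_T: "group FAut_T"
  using subgroup.subgroup_is_group[OF subgroup_FAut_T group_Aut_T] by (simp add: FAut_T_def)

end

theory Submission
  imports Defs
begin

text \<open>
  Elements of a contracting group are finite-state, so \<open>a\<close> and \<open>b\<close> are, and a finite-state
  conjugator is a conjugator. The content is the construction of a finite-state conjugator from an
  arbitrary one.

  Let \<open>c\<close> and \<open>d\<close> be conjugate. A conjugator permutes letters by some permutation that carries
  the orbits of \<open>c\<close> on letters to those of \<open>d\<close>. On an orbit with representative \<open>r\<close>, of length \<open>m\<close>,
  its state at \<open>r\<close> conjugates the first return \<open>c\<^sup>m|\<^sub>r\<close> to the first return of \<open>d\<close> at the
  image \<open>r'\<close> of \<open>r\<close>, and its states at the images of \<open>r\<close> under \<open>c\<^sup>i\<close> are then forced: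
  each is the state at \<open>r\<close>, multiplied on the left by the inverse of \<open>c\<^sup>i|\<^sub>r\<close> and on the right by the
  state of \<open>d\<^sup>i\<close> at \<open>r'\<close>. Conversely, with the same permutation of letters, any choice of
  conjugators between the first returns, one for each orbit, yields a conjugator of \<open>c\<close> and \<open>d\<close>.
  First returns of first returns are first returns, so every pair that occurs below \<open>(a, b)\<close> lies in the product of the two orbit-signalizers, which is
  finite. Always choosing the same conjugator \<open>F (c, d)\<close> for the same pair gives a family defined
  by recursion along the tree (\<open>compatible_conjugators\<close>).

  The family is finite, yet its members need not be finite-state a priori: descending along a word
  accumulates the forced factors, and a state of \<open>F (a, b)\<close> has the form
  \<open>p\<^sup>-\<^sup>1 F (c, d) s\<close>, where passing to the next letter replaces \<open>p\<close> by \<open>l p|\<^sub>x\<close> with \<open>l\<close> from a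
  fixed finite subset of the group generated by the states of \<open>a\<close>, and similarly \<open>s\<close> with \<open>b\<close>.
  This is where contraction enters: passing to deep states halves the word length, while each
  step adds only one factor, so the lengths of all elements obtained in this way are bounded
  (\<open>contracting_group_finite_closure\<close>). Hence only finitely many \<open>p\<close> and \<open>s\<close> occur, and
  \<open>F (a, b)\<close> is finite-state.
\<close>

section \<open>Tree automorphisms as functions\<close>

lemma mult_Aut_T_apply: "(g \<otimes>\<^bsub>Aut_T\<^esub> h) w = h (g w)"
  by (simp add: Aut_T_def)

lemma pow_Aut_T: "g [^]\<^bsub>Aut_T\<^esub> (n::nat) = g ^^ n"
proof -
  interpret group "Aut_T :: ('a list \<Rightarrow> 'a list) monoid" by (rule group_Aut_T)
  show ?thesis
  proof (induction n)
    case 0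
    show ?case by (simp add: Aut_T_def id_def)
  next
    case (Suc n)
    then show ?case by (simp add: fun_eq_iff mult_Aut_T_apply)
  qed
qed

lemma funpow_Aut_T:
  assumes "g \<in> carrier Aut_T"
  shows "g ^^ n \<in> carrier Aut_T"
  using monoid.nat_pow_closed[OF group.is_monoid[OF group_Aut_T] assms, of n]
  by (simp add: pow_Aut_T)

lemma inv_Aut_T_apply:
  assumes "g \<in> carrier Aut_T"
  shows "g ((inv\<^bsub>Aut_T\<^esub> g) w) = w" and "(inv\<^bsub>Aut_T\<^esub> g) (g w) = w"
  using group.l_inv[OF group_Aut_T assms] group.r_inv[OF group_Aut_T assms]
  by (metis mult_Aut_T_apply state_Nil state_one Aut_T_def id_apply monoid.simps(2))+

lemma Aut_T_length: "g \<in> carrier Aut_T \<Longrightarrow> length (g v) = length v"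
  by (rule tree_auts_length) (simp add: Aut_T_def)

lemma Aut_T_inject: "g \<in> carrier Aut_T \<Longrightarrow> g v = g w \<longleftrightarrow> v = w"
  by (metis inv_Aut_T_apply(2))

lemma funpow_conjugate:
  assumes "\<And>w. k (c w) = d (k w)"
  shows "k ((c ^^ n) w) = (d ^^ n) (k w)"
  by (induction n) (simp_all add: assms)

section \<open>Orbits and first returns\<close>

text \<open>The orbit of a word stays inside its level, which is finite.\<close>

lemma ex_return:
  fixes g :: "'x::finite list \<Rightarrow> 'x list"
  assumes g: "g \<in> carrier Aut_T"
  shows "\<exists>m>0. (g ^^ m) v = v"
proof -
  have "range (\<lambda>n. (g ^^ n) v) \<subseteq> {w. set w \<subseteq> UNIV \<and> length w = length v}"
    using Aut_T_length[OF funpow_Aut_T[OF g]] by auto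
  then have "finite (range (\<lambda>n. (g ^^ n) v))"
    by (rule finite_subset) (rule finite_lists_length_eq, simp)
  then have "\<not> inj (\<lambda>n. (g ^^ n) v)" using finite_imageD by blast
  then obtain i j where ij: "i < j" "(g ^^ i) v = (g ^^ j) v"
    by (metis (mono_tags, lifting) injI linorder_neqE_nat)
  then have "(g ^^ i) v = (g ^^ i) ((g ^^ (j - i)) v)"
    by (simp flip: comp_apply[of "g ^^ i"] funpow_add)
  then have "(g ^^ (j - i)) v = v"
    using Aut_T_inject[OF funpow_Aut_T[OF g]] by metis
  then show ?thesis using ij by (intro exI[of _ "j - i"]) simp
qed

lemma funpow_mult_fixed: "(g ^^ m) v = v \<Longrightarrow> (g ^^ (n * m)) v = v"
  by (induction n) (simp_all add: funpow_add)

lemma Orb_eq_range: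
  fixes g :: "'x::finite list \<Rightarrow> 'x list"
  assumes g: "g \<in> carrier Aut_T"
  shows "Orb g v = range (\<lambda>n. (g ^^ n) v)"
proof (intro equalityI subsetI)
  interpret group "Aut_T :: ('x list \<Rightarrow> 'x list) monoid" by (rule group_Aut_T)
  fix w assume "w \<in> Orb g v"
  then obtain k :: int where w: "w = (g [^]\<^bsub>Aut_T\<^esub> k) v" by (auto simp: Orb_def)
  obtain m where m: "m > 0" "(g ^^ m) v = v" using ex_return[OF g] by blast
  show "w \<in> range (\<lambda>n. (g ^^ n) v)"
  proof (cases "k \<ge> 0")
    case True
    then have "w = (g ^^ nat k) v" using w by (simp add: int_pow_def2 pow_Aut_T)
    then show ?thesis by blast
  next
    case False
    define n where "n = nat (- k)"
    have "w = (inv\<^bsub>Aut_T\<^esub> (g ^^ n)) v" using w False by (simp add: int_pow_def2 pow_Aut_T n_def)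
    then have "(g ^^ n) w = v" using inv_Aut_T_apply(1)[OF funpow_Aut_T[OF g]] by simp
    moreover have "(g ^^ n) ((g ^^ (n * m - n)) v) = v"
      using funpow_mult_fixed[OF m(2), of n] m(1)
      by (simp flip: comp_apply[of "g ^^ n"] funpow_add)
    ultimately show ?thesis using Aut_T_inject[OF funpow_Aut_T[OF g], of n] by (metis rangeI)
  qed
next
  interpret group "Aut_T :: ('x list \<Rightarrow> 'x list) monoid" by (rule group_Aut_T)
  fix w assume "w \<in> range (\<lambda>n. (g ^^ n) v)"
  then obtain n where "w = (g ^^ n) v" by blast
  then have "w = (g [^]\<^bsub>Aut_T\<^esub> int n) v" by (simp add: int_pow_int pow_Aut_T)
  then show "w \<in> Orb g v" by (auto simp: Orb_def)
qed

text \<open>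
  This divisibility characterises the orbit length, and all later computations of orbit lengths
  compare the sets of exponents that fix two words.
\<close>

lemma funpow_fixed_iff_card_Orb_dvd:
  fixes g :: "'x::finite list \<Rightarrow> 'x list"
  assumes g: "g \<in> carrier Aut_T"
  shows "(g ^^ n) v = v \<longleftrightarrow> card (Orb g v) dvd n"
proof -
  define m where "m = (LEAST m. m > 0 \<and> (g ^^ m) v = v)"
  have m: "m > 0" "(g ^^ m) v = v"
    using LeastI_ex[OF ex_return[OF g, of v]] by (auto simp: m_def)
  have least: "\<not> (0 < j \<and> (g ^^ j) v = v)" if "j < m" for j
    using not_less_Least that unfolding m_def by blast
  have red: "(g ^^ n) v = (g ^^ (n mod m)) v" for n
  proof -
    have "(g ^^ n) v = (g ^^ (n mod m)) ((g ^^ (n div m * m)) v)"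
      by (simp flip: comp_apply[of "g ^^ (n mod m)"] funpow_add)
    then show ?thesis by (simp add: funpow_mult_fixed[OF m(2)])
  qed
  have fixed: "(g ^^ n) v = v \<longleftrightarrow> m dvd n" for n
    using least[of "n mod m"] m(1) red[of n] by (auto simp: mod_eq_0_iff_dvd)
  have "(g ^^ n) v \<in> (\<lambda>n. (g ^^ n) v) ` {..<m}" for n
    using red[of n] m(1) by (metis imageI lessThan_iff mod_less_divisor)
  then have "range (\<lambda>n. (g ^^ n) v) = (\<lambda>n. (g ^^ n) v) ` {..<m}" by blast
  moreover have "inj_on (\<lambda>n. (g ^^ n) v) {..<m}"
  proof (rule linorder_inj_onI)
    fix i j assume ij: "i < j" "i \<in> {..<m}" "j \<in> {..<m}"
    show "(g ^^ i) v \<noteq> (g ^^ j) v"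
    proof
      assume "(g ^^ i) v = (g ^^ j) v"
      then have "(g ^^ i) v = (g ^^ i) ((g ^^ (j - i)) v)"
        using ij by (simp flip: comp_apply[of "g ^^ i"] funpow_add)
      then have "(g ^^ (j - i)) v = v"
        using Aut_T_inject[OF funpow_Aut_T[OF g]] by metis
      moreover have "j - i < m" using ij by auto
      ultimately show False using least[of "j - i"] ij(1) by simp
    qed
  qed auto
  ultimately have "card (Orb g v) = m" by (simp add: Orb_eq_range[OF g] card_image)
  then show ?thesis using fixed by simp
qed

lemma funpow_card_Orb:
  fixes g :: "'x::finite list \<Rightarrow> 'x list"
  shows "g \<in> carrier Aut_T \<Longrightarrow> (g ^^ card (Orb g v)) v = v"
  by (simp add: funpow_fixed_iff_card_Orb_dvd)

lemma Orb_refl: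
  fixes g :: "'x::finite list \<Rightarrow> 'x list"
  shows "g \<in> carrier Aut_T \<Longrightarrow> v \<in> Orb g v"
  by (metis Orb_eq_range funpow_0 rangeI)

lemma Orb_step:
  fixes g :: "'x::finite list \<Rightarrow> 'x list"
  assumes g: "g \<in> carrier Aut_T"
  shows "Orb g (g v) = Orb g v"
proof -
  obtain m where m: "m > 0" "(g ^^ m) v = v" using ex_return[OF g] by blast
  have "(g ^^ n) (g v) = (g ^^ Suc n) v" for n by (simp only: funpow_Suc_right comp_apply)
  moreover have "(g ^^ n) v = (g ^^ (n + (m - 1))) (g v)" for n
  proof -
    have "(g ^^ (n + (m - 1))) (g v) = (g ^^ (n + m)) v"
      using m(1) by (cases m) (simp_all add: funpow_swap1)
    then show ?thesis using m by (simp add: funpow_add)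
  qed
  ultimately show ?thesis
    unfolding Orb_eq_range[OF g] by (metis (no_types, lifting) image_subsetI rangeI subset_antisym)
qed

lemma Orb_sym:
  fixes g :: "'x::finite list \<Rightarrow> 'x list"
  assumes g: "g \<in> carrier Aut_T" and w: "w \<in> Orb g v"
  shows "v \<in> Orb g w"
proof -
  obtain n where n: "w = (g ^^ n) v" using w by (auto simp: Orb_eq_range[OF g])
  have "Orb g ((g ^^ n) v) = Orb g v" by (induction n) (simp_all add: Orb_step[OF g])
  then show ?thesis using n Orb_refl[OF g] by simp
qed

definition return_state :: "('x list \<Rightarrow> 'x list) \<Rightarrow> 'x list \<Rightarrow> ('x list \<Rightarrow> 'x list)" where
  "return_state g v = state (g ^^ card (Orb g v)) v"

lemma orbit_signalizer_eq: "orbit_signalizer a = range (return_state a)"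
  by (auto simp: orbit_signalizer_def return_state_def pow_Aut_T)

lemma return_state_Aut_T: "g \<in> carrier Aut_T \<Longrightarrow> return_state g v \<in> carrier Aut_T"
  by (simp add: return_state_def state_in_Aut_T funpow_Aut_T)

lemma funpow_return_state:
  fixes g :: "'x::finite list \<Rightarrow> 'x list"
  assumes g: "g \<in> carrier Aut_T"
  shows "(g ^^ (n * card (Orb g v))) (v @ w) = v @ (return_state g v ^^ n) w"
proof (induction n)
  case (Suc n)
  have "(g ^^ card (Orb g v)) (v @ u) = v @ return_state g v u" for u
    using state_append[OF funpow_Aut_T[OF g]] by (simp add: return_state_def funpow_card_Orb[OF g])
  then show ?case using Suc by (simp add: funpow_add)
qed simp

text \<open>
  A power of \<open>g\<close> can fix \<open>v @ w\<close> only if its exponent is a multiple of the orbit length of \<open>v\<close>;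
  such a power acts below \<open>v\<close> as a power of the first return.
\<close>

lemma card_Orb_append:
  fixes g :: "'x::finite list \<Rightarrow> 'x list"
  assumes g: "g \<in> carrier Aut_T"
  shows "card (Orb g (v @ w)) = card (Orb (return_state g v) w) * card (Orb g v)"
proof -
  let ?m = "card (Orb g v)" and ?c = "return_state g v"
  have m0: "?m > 0"
    using ex_return[OF g, of v] by (auto simp: funpow_fixed_iff_card_Orb_dvd[OF g] )
  have "(g ^^ n) (v @ w) = v @ w \<longleftrightarrow> card (Orb ?c w) * ?m dvd n" for n
  proof (cases "?m dvd n")
    case True
    then obtain t where "n = t * ?m" by (metis dvd_def mult.commute)
    then show ?thesis
      using m0 by (simp add: funpow_return_state[OF g]
          funpow_fixed_iff_card_Orb_dvd[OF return_state_Aut_T[OF g]])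
  next
    case False
    then have "(g ^^ n) v \<noteq> v" by (simp add: funpow_fixed_iff_card_Orb_dvd[OF g])
    then have "(g ^^ n) (v @ w) \<noteq> v @ w"
      using state_append[OF funpow_Aut_T[OF g], of n v w] Aut_T_length[OF funpow_Aut_T[OF g]]
      by simp
    then show ?thesis using False by (metis dvd_mult_right)
  qed
  then show ?thesis
    by (metis dvd_antisym dvd_refl funpow_fixed_iff_card_Orb_dvd[OF g])
qed

text \<open>It is this law that keeps the recursive construction inside an orbit-signalizer.\<close>

lemma return_state_append:
  fixes g :: "'x::finite list \<Rightarrow> 'x list"
  assumes g: "g \<in> carrier Aut_T"
  shows "return_state (return_state g v) w = return_state g (v @ w)"
proof -
  let ?c = "return_state g v"
  have "state (?c ^^ card (Orb ?c w)) w = state (state (g ^^ card (Orb g (v @ w))) v) w"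
  proof (rule arg_cong[where f = "\<lambda>h. state h w"], rule sym, rule state_eqI[OF funpow_Aut_T[OF g]])
    fix u
    show "(g ^^ card (Orb g (v @ w))) (v @ u)
        = (g ^^ card (Orb g (v @ w))) v @ (?c ^^ card (Orb ?c w)) u"
      using funpow_return_state[OF g, where v = v] funpow_mult_fixed[OF funpow_card_Orb[OF g, of v]]
      by (simp add: card_Orb_append[OF g])
  qed
  then show ?thesis by (simp add: return_state_def state_state[OF funpow_Aut_T[OF g]])
qed

section \<open>Conjugators\<close>

definition conjugator :: "('x list \<Rightarrow> 'x list) \<Rightarrow> ('x list \<Rightarrow> 'x list) \<Rightarrow> ('x list \<Rightarrow> 'x list) \<Rightarrow> bool" where
  "conjugator c d k \<longleftrightarrow> k \<in> carrier Aut_T \<and> (\<forall>w. k (c w) = d (k w))"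

lemma conjugator_iff:
  assumes c: "c \<in> carrier Aut_T" and d: "d \<in> carrier Aut_T" and k: "k \<in> carrier Aut_T"
  shows "conjugator c d k \<longleftrightarrow> d = inv\<^bsub>Aut_T\<^esub> k \<otimes>\<^bsub>Aut_T\<^esub> c \<otimes>\<^bsub>Aut_T\<^esub> k"
proof -
  have "(\<forall>w. k (c w) = d (k w)) \<longleftrightarrow> (\<forall>w. d w = k (c ((inv\<^bsub>Aut_T\<^esub> k) w)))"
    by (metis inv_Aut_T_apply[OF k])
  then show ?thesis using k by (simp add: conjugator_def fun_eq_iff mult_Aut_T_apply)
qed

lemma conjugator_card_Orb:
  fixes c d :: "'x::finite list \<Rightarrow> 'x list"
  assumes c: "c \<in> carrier Aut_T" and d: "d \<in> carrier Aut_T" and k: "conjugator c d k"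
  shows "card (Orb d (k v)) = card (Orb c v)"
proof -
  have "(d ^^ n) (k v) = k v \<longleftrightarrow> (c ^^ n) v = v" for n
    using k funpow_conjugate[of k c d n v] by (metis Aut_T_inject conjugator_def)
  then show ?thesis
    by (metis c d dvd_antisym dvd_refl funpow_fixed_iff_card_Orb_dvd)
qed

text \<open>
  The orbits of \<open>v\<close> under \<open>c\<close> and of \<open>k v\<close> under \<open>d\<close> have the same length, so \<open>k\<close> intertwines
  the two powers whose states are the first returns; restrict this relation to the words below
  \<open>v\<close>.
\<close>

lemma conjugator_return_state:
  fixes c d :: "'x::finite list \<Rightarrow> 'x list"
  assumes c: "c \<in> carrier Aut_T" and d: "d \<in> carrier Aut_T" and k: "conjugator c d k"
  shows "conjugator (return_state c v) (return_state d (k v)) (state k v)"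
proof -
  have kA: "k \<in> carrier Aut_T" and kc: "\<And>w. k (c w) = d (k w)"
    using k by (auto simp: conjugator_def)
  have "state k v (return_state c v w) = return_state d (k v) (state k v w)" for w
  proof -
    have "k v @ state k v (return_state c v w) = k ((c ^^ card (Orb c v)) (v @ w))"
      using funpow_return_state[OF c, of 1 v w] by (simp add: state_append[OF kA])
    also have "\<dots> = (d ^^ card (Orb d (k v))) (k v @ state k v w)"
      by (simp add: funpow_conjugate[of k c d, OF kc] state_append[OF kA] conjugator_card_Orb[OF c d k])
    also have "\<dots> = k v @ return_state d (k v) (state k v w)"
      using funpow_return_state[OF d, of 1 "k v"] by simp
    finally show ?thesis by simp
  qed
  then show ?thesis by (simp add: conjugator_def state_in_Aut_T[OF kA])
qed


section \<open>Bounded accumulation in contracting groups\<close>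

lemma self_in_states: "g \<in> carrier Aut_T \<Longrightarrow> g \<in> states g"
  unfolding states_def using state_Nil[of g] by (metis (mono_tags, lifting) mem_Collect_eq)

lemma contracting_group_finite_states:
  fixes G :: "('x::finite list \<Rightarrow> 'x list) set"
  assumes G: "contracting_group G" and g: "g \<in> G"
  shows "finite (states g)"
proof -
  obtain N n where N: "finite N" "\<And>v. n \<le> length v \<Longrightarrow> state g v \<in> N"
    using G g unfolding contracting_group_def by meson
  have "states g \<subseteq> N \<union> state g ` {v. set v \<subseteq> UNIV \<and> length v \<le> n}"
    using N(2) by (force simp: states_def)
  moreover have "finite {v :: 'x list. set v \<subseteq> UNIV \<and> length v \<le> n}"
    by (rule finite_lists_length_le) simp
  ultimately show ?thesis using N(1) by (meson finite_UnI finite_imageI finite_subset)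
qed

primrec products :: "('x list \<Rightarrow> 'x list) set \<Rightarrow> nat \<Rightarrow> ('x list \<Rightarrow> 'x list) set" where
  "products M 0 = {\<one>\<^bsub>Aut_T\<^esub>}"
| "products M (Suc m) = (\<lambda>(s, t). s \<otimes>\<^bsub>Aut_T\<^esub> t) ` (M \<times> products M m)"

lemma products_Aut_T: "M \<subseteq> carrier Aut_T \<Longrightarrow> products M m \<subseteq> carrier Aut_T"
proof (induction m)
  case (Suc m)
  then show ?case using monoid.m_closed[OF group.is_monoid[OF group_Aut_T]] by fastforce
qed (simp add: monoid.one_closed[OF group.is_monoid[OF group_Aut_T]])

lemma finite_products: "finite M \<Longrightarrow> finite (products M m)"
  by (induction m) auto

lemma products_mult:
  assumes M: "M \<subseteq> carrier Aut_T" and "s \<in> products M i" and t: "t \<in> products M j"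
  shows "s \<otimes>\<^bsub>Aut_T\<^esub> t \<in> products M (i + j)"
  using assms(2)
proof (induction i arbitrary: s)
  interpret group "Aut_T :: ('a list \<Rightarrow> 'a list) monoid" by (rule group_Aut_T)
  have tA: "t \<in> carrier Aut_T" using products_Aut_T[OF M] t by blast
  {
    case 0
    then show ?case using t tA by simp
  next
    case (Suc i)
    then obtain g u where g: "s = g \<otimes>\<^bsub>Aut_T\<^esub> u" "g \<in> M" "u \<in> products M i" by auto
    then have "s \<otimes>\<^bsub>Aut_T\<^esub> t = g \<otimes>\<^bsub>Aut_T\<^esub> (u \<otimes>\<^bsub>Aut_T\<^esub> t)"
      using products_Aut_T[OF M, of i] M tA by (simp add: m_assoc subset_iff)
    then show ?case using Suc.IH[OF g(3)] g(2) by auto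
  }
qed

lemma products_mono:
  assumes M: "M \<subseteq> carrier Aut_T" and one: "\<one>\<^bsub>Aut_T\<^esub> \<in> M" and ij: "i \<le> j"
  shows "products M i \<subseteq> products M j"
proof -
  interpret group "Aut_T :: ('a list \<Rightarrow> 'a list) monoid" by (rule group_Aut_T)
  have "products M i \<subseteq> products M (Suc i)" for i
  proof
    fix p assume p: "p \<in> products M i"
    then have "p = \<one>\<^bsub>Aut_T\<^esub> \<otimes>\<^bsub>Aut_T\<^esub> p" using products_Aut_T[OF M, of i] by auto
    then show "p \<in> products M (Suc i)" using one p by (auto intro: rev_image_eqI)
  qed
  then show ?thesis using ij by (rule lift_Suc_mono_le)
qed

lemma state_products:
  assumes M: "M \<subseteq> carrier Aut_T" and st: "\<And>s v. s \<in> M \<Longrightarrow> state s v \<in> M"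
    and "p \<in> products M m"
  shows "state p v \<in> products M m"
  using assms(3)
proof (induction m arbitrary: p v)
  case 0
  then show ?case by (simp add: state_one)
next
  case (Suc m)
  then obtain s t where p: "p = s \<otimes>\<^bsub>Aut_T\<^esub> t" "s \<in> M" "t \<in> products M m" by auto
  then have "state p v = state s v \<otimes>\<^bsub>Aut_T\<^esub> state t (s v)"
    using M products_Aut_T[OF M, of m] by (auto intro: state_mult)
  then show ?case using st[OF p(2)] Suc.IH[OF p(3)] by auto
qed

text \<open>
  Pair up the factors of a product of even length: at depth \<open>n\<close> each pair collapses to a single
  element of \<open>M\<close>.
\<close>

lemma state_products_halve:
  assumes M: "M \<subseteq> carrier Aut_T"
    and pair: "\<And>s t v. s \<in> M \<Longrightarrow> t \<in> M \<Longrightarrow> n \<le> length v \<Longrightarrow> state (s \<otimes>\<^bsub>Aut_T\<^esub> t) v \<in> M"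
    and "p \<in> products M (2 * m)" and "n \<le> length v"
  shows "state p v \<in> products M m"
  using assms(3,4)
proof (induction m arbitrary: p v)
  case 0
  then show ?case by (simp add: state_one)
next
  case (Suc m)
  interpret group "Aut_T :: ('a list \<Rightarrow> 'a list) monoid" by (rule group_Aut_T)
  obtain s t u where p: "p = s \<otimes>\<^bsub>Aut_T\<^esub> (t \<otimes>\<^bsub>Aut_T\<^esub> u)" "s \<in> M" "t \<in> M" "u \<in> products M (2 * m)"
    using Suc.prems(1) by auto
  have c: "s \<in> carrier Aut_T" "t \<in> carrier Aut_T" "u \<in> carrier Aut_T"
    using p M products_Aut_T[OF M] by blast+
  then have "state p v = state (s \<otimes>\<^bsub>Aut_T\<^esub> t) v \<otimes>\<^bsub>Aut_T\<^esub> state u ((s \<otimes>\<^bsub>Aut_T\<^esub> t) v)"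
    by (simp add: p(1) state_mult flip: m_assoc)
  moreover have "length ((s \<otimes>\<^bsub>Aut_T\<^esub> t) v) = length v" using c by (simp add: Aut_T_length)
  ultimately show ?case
    using pair[OF p(2,3) Suc.prems(2)] Suc.IH[OF p(4), of "(s \<otimes>\<^bsub>Aut_T\<^esub> t) v"] Suc.prems(2) by auto
qed

text \<open>
  Let \<open>M\<close> be the finite set of all states of the elements of \<open>S\<close>, of the nucleus \<open>N\<close> and of the
  identity, and let \<open>n\<close> be a depth at which products of two elements of \<open>M\<close> have their states in
  \<open>N \<subseteq> M\<close>. Starting from the identity and iterating \<open>p \<mapsto> l p|\<^sub>x\<close>, all elements obtained are
  products of \<open>2 * n\<close> factors from \<open>M\<close>: going \<open>n\<close> steps back, such a product loses half of its
  factors in the descent by \<open>n\<close> levels and regains \<open>n\<close> factors, one in each step.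
\<close>

lemma contracting_group_finite_closure:
  fixes G :: "('x::finite list \<Rightarrow> 'x list) set"
  assumes G: "contracting_group G" and S: "finite S" "S \<subseteq> G"
  obtains K where "finite K" "K \<subseteq> carrier Aut_T" "\<one>\<^bsub>Aut_T\<^esub> \<in> K"
    "\<And>p l x. p \<in> K \<Longrightarrow> l \<in> S \<Longrightarrow> l \<otimes>\<^bsub>Aut_T\<^esub> state p [x] \<in> K"
proof -
  interpret group "Aut_T :: ('x list \<Rightarrow> 'x list) monoid" by (rule group_Aut_T)
  have sub: "subgroup G Aut_T" and ss: "\<And>g v. g \<in> G \<Longrightarrow> state g v \<in> G"
    using G by (auto simp: contracting_group_def self_similar_def)
  have GA: "G \<subseteq> carrier Aut_T" by (rule subgroup.subset[OF sub])
  obtain N where N: "finite N" "N \<subseteq> G"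
    and contr: "\<And>g. g \<in> G \<Longrightarrow> \<exists>n. \<forall>v. n \<le> length v \<longrightarrow> state g v \<in> N"
    using G unfolding contracting_group_def by metis
  define M where "M = \<Union> (states ` insert \<one>\<^bsub>Aut_T\<^esub> (N \<union> S))"
  have gen: "insert \<one>\<^bsub>Aut_T\<^esub> (N \<union> S) \<subseteq> G" using N S subgroup.one_closed[OF sub] by blast
  have finM: "finite M"
    unfolding M_def using gen N S contracting_group_finite_states[OF G] by blast
  have MG: "M \<subseteq> G" using gen ss by (auto simp: M_def states_def)
  then have MA: "M \<subseteq> carrier Aut_T" using GA by blast
  have self: "g \<in> states g" if "g \<in> G" for g
    using that GA self_in_states by blast
  have inM: "insert \<one>\<^bsub>Aut_T\<^esub> (N \<union> S) \<subseteq> M" using gen self unfolding M_def by blast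
  have stM: "state g v \<in> M" if "g \<in> M" for g v
    using that gen GA by (auto simp: M_def states_def state_state subset_iff) blast+
  obtain n where n: "n > 0"
    "\<And>s t v. s \<in> M \<Longrightarrow> t \<in> M \<Longrightarrow> n \<le> length v \<Longrightarrow> state (s \<otimes>\<^bsub>Aut_T\<^esub> t) v \<in> M"
  proof -
    have "s \<otimes>\<^bsub>Aut_T\<^esub> t \<in> G" if "s \<in> M" "t \<in> M" for s t
      using that MG subgroup.m_closed[OF sub] by blast
    then have "\<forall>s t. \<exists>m. s \<in> M \<longrightarrow> t \<in> M \<longrightarrow>
        (\<forall>v. m \<le> length v \<longrightarrow> state (s \<otimes>\<^bsub>Aut_T\<^esub> t) v \<in> N)"
      using contr by blast
    then obtain f where f: "\<And>s t v. s \<in> M \<Longrightarrow> t \<in> M \<Longrightarrow> f s t \<le> length v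
        \<Longrightarrow> state (s \<otimes>\<^bsub>Aut_T\<^esub> t) v \<in> N"
      by metis
    have "finite ((\<lambda>(s, t). f s t) ` (M \<times> M))" using finM by blast
    then obtain m where "\<forall>i \<in> (\<lambda>(s, t). f s t) ` (M \<times> M). i \<le> m"
      using finite_nat_set_iff_bounded_le by auto
    then have m: "f s t \<le> m" if "s \<in> M" "t \<in> M" for s t using that by auto
    (* the successor makes n positive: bound below recurses from j to j - n *)
    show ?thesis
    proof (rule that[of "Suc m"])
      fix s t v assume "s \<in> M" "t \<in> M" "Suc m \<le> length (v :: 'x list)"
      then show "state (s \<otimes>\<^bsub>Aut_T\<^esub> t) v \<in> M" using f[of s t v] m[of s t] inM by auto
    qed simp
  qed
  define R where
    "R j = ((\<lambda>A. {l \<otimes>\<^bsub>Aut_T\<^esub> state p [x] | l p x. l \<in> S \<and> p \<in> A}) ^^ j) {\<one>\<^bsub>Aut_T\<^esub>}" for j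
  have R0: "R 0 = {\<one>\<^bsub>Aut_T\<^esub>}"
    and RSuc: "R (Suc j) = {l \<otimes>\<^bsub>Aut_T\<^esub> state p [x] | l p x. l \<in> S \<and> p \<in> R j}" for j
    by (simp_all add: R_def)
  have RA: "R j \<subseteq> carrier Aut_T" for j
  proof (induction j)
    case (Suc j)
    then show ?case using S GA by (auto simp: RSuc intro!: m_closed state_in_Aut_T)
  qed (simp add: R0)
  (* i steps amount to one passage to a state at depth i followed by i new factors *)
  have unfold: "\<exists>q\<in>R j. \<exists>v. \<exists>t\<in>products M i. length v = i \<and> p = t \<otimes>\<^bsub>Aut_T\<^esub> state q v"
    if "p \<in> R (j + i)" for p i j
    using that
  proof (induction i arbitrary: p)
    case 0
    then have "p \<in> carrier Aut_T" using RA[of j] by auto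
    then have "p = \<one>\<^bsub>Aut_T\<^esub> \<otimes>\<^bsub>Aut_T\<^esub> state p []" by (simp add: state_Nil)
    then have "\<exists>t\<in>products M 0. length [] = 0 \<and> p = t \<otimes>\<^bsub>Aut_T\<^esub> state p []" by simp
    then show ?case using 0 by (metis add_0_right)
  next
    case (Suc i)
    then obtain l p' x where l: "p = l \<otimes>\<^bsub>Aut_T\<^esub> state p' [x]" "l \<in> S" "p' \<in> R (j + i)"
      by (auto simp: RSuc)
    obtain q v t where q: "q \<in> R j" "t \<in> products M i" "length v = i"
      "p' = t \<otimes>\<^bsub>Aut_T\<^esub> state q v"
      using Suc.IH[OF l(3)] by blast
    have qA: "q \<in> carrier Aut_T" and tA: "t \<in> carrier Aut_T" and lA: "l \<in> carrier Aut_T"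
      using q l RA products_Aut_T[OF MA] S GA by blast+
    have "state p' [x] = state t [x] \<otimes>\<^bsub>Aut_T\<^esub> state q (v @ t [x])"
      by (simp add: q(4) state_mult tA qA state_in_Aut_T state_state)
    then have "p = (l \<otimes>\<^bsub>Aut_T\<^esub> state t [x]) \<otimes>\<^bsub>Aut_T\<^esub> state q (v @ t [x])"
      using lA tA qA by (simp add: l(1) m_assoc state_in_Aut_T)
    moreover have "l \<otimes>\<^bsub>Aut_T\<^esub> state t [x] \<in> products M (Suc i)"
      using l(2) inM state_products[OF MA stM q(2)] by auto
    moreover have "length (v @ t [x]) = Suc i" using q(3) Aut_T_length[OF tA] by simp
    ultimately show ?case using q(1) by blast
  qed
  have bound: "R j \<subseteq> products M (2 * n)" for j
  proof (induction j rule: less_induct)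
    case (less j)
    show ?case
    proof
      fix p assume p: "p \<in> R j"
      show "p \<in> products M (2 * n)"
      proof (cases "j \<le> 2 * n")
        case True
        obtain t v where "t \<in> products M j" "p = t \<otimes>\<^bsub>Aut_T\<^esub> state \<one>\<^bsub>Aut_T\<^esub> v"
          using unfold[of p 0 j] p by (auto simp: R0)
        then have "p \<in> products M j"
          using products_Aut_T[OF MA, of j] by (auto simp: state_one)
        then show ?thesis using products_mono[OF MA _ True] inM by blast
      next
        case False
        then obtain q v t where q: "q \<in> R (j - n)" "t \<in> products M n" "length v = n"
          "p = t \<otimes>\<^bsub>Aut_T\<^esub> state q v"
          using unfold[of p "j - n" n] p by auto
        have q2n: "q \<in> products M (2 * n)" using less.IH[of "j - n"] q(1) n(1) False by auto
        have "state q v \<in> products M n"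
          by (rule state_products_halve[where n = n, OF MA _ q2n]) (simp_all add: n(2) q(3))
        then show ?thesis using products_mult[OF MA q(2)] q(4) by (simp add: mult_2)
      qed
    qed
  qed
  show ?thesis
  proof
    show "finite (\<Union> (range R))" using finite_products[OF finM] bound by (meson UN_least finite_subset)
    show "\<Union> (range R) \<subseteq> carrier Aut_T" using RA by blast
    show "\<one>\<^bsub>Aut_T\<^esub> \<in> \<Union> (range R)" using R0 by blast
    show "l \<otimes>\<^bsub>Aut_T\<^esub> state p [x] \<in> \<Union> (range R)" if "p \<in> \<Union> (range R)" "l \<in> S" for p l x
      using that RSuc by blast
  qed
qed

section \<open>Automorphisms defined by recursion along the tree\<close>

lemma Aut_TI:
  fixes g :: "'x::finite list \<Rightarrow> 'x list"
  assumes len: "\<And>w. length (g w) = length w" and ext: "\<And>w x. \<exists>y. g (w @ [x]) = g w @ [y]"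
    and inj: "inj g"
  shows "g \<in> carrier Aut_T"
proof -
  have "\<exists>u. g u = w" for w
  proof -
    let ?L = "{u :: 'x list. set u \<subseteq> UNIV \<and> length u = length w}"
    have "finite ?L" by (rule finite_lists_length_eq) simp
    then have "g ` ?L = ?L"
      by (rule endo_inj_surj) (use len inj in \<open>auto intro: inj_on_subset\<close>)
    moreover have "w \<in> ?L" by simp
    ultimately have "w \<in> g ` ?L" by (simp only:)
    then show ?thesis by blast
  qed
  then have "bij g" using inj by (metis bij_def surj_def)
  moreover have "g [] = []" using len[of "[]"] by simp
  moreover have "(\<exists>y. g u = g v @ [y]) \<longleftrightarrow> (\<exists>x. u = v @ [x])" for u v
  proof
    assume "\<exists>y. g u = g v @ [y]"
    then obtain y where y: "g u = g v @ [y]" by blast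
    then have "length u = Suc (length v)" using len[of u] len[of v] by simp
    then obtain u' x where u: "u = u' @ [x]" by (metis append_butlast_last_id length_0_conv nat.distinct(1))
    then have "g u' = g v" using y ext[of u' x] by auto
    then show "\<exists>x. u = v @ [x]" using u inj by (auto dest: injD)
  qed (use ext in blast)
  ultimately show ?thesis
    by (auto simp: Aut_T_def tree_auts_def tree_adj_def ex_disj_distrib)
qed

text \<open>
  The recursion descends to \<open>L q x\<close> of the tail, an arbitrary function at this point, so its
  termination is ensured by a separate counter, which is to be the length of the word.
\<close>

primrec wreath_rec ::
  "('q \<Rightarrow> 'x \<Rightarrow> 'x) \<Rightarrow> ('q \<Rightarrow> 'x \<Rightarrow> 'q) \<Rightarrow> ('q \<Rightarrow> 'x \<Rightarrow> 'x list \<Rightarrow> 'x list) \<Rightarrow>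
   ('q \<Rightarrow> 'x \<Rightarrow> 'x list \<Rightarrow> 'x list) \<Rightarrow> nat \<Rightarrow> 'q \<Rightarrow> 'x list \<Rightarrow> 'x list" where
  "wreath_rec P T L R 0 q w = []"
| "wreath_rec P T L R (Suc n) q w =
    P q (hd w) # R q (hd w) (wreath_rec P T L R n (T q (hd w)) (L q (hd w) (tl w)))"

text \<open>
  The recursion prescribes the action of \<open>F q\<close> on the first level by \<open>P q\<close>, and its state at a
  letter \<open>x\<close> to be the product of \<open>L q x\<close>, \<open>F (T q x)\<close> and \<open>R q x\<close>. Since automorphisms preserve
  length, such a system has a solution, and the solution inherits injectivity and compatibility
  with prefixes level by level.
\<close>

lemma wreath_recursion:
  fixes P :: "'q \<Rightarrow> 'x::finite \<Rightarrow> 'x"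
  assumes P: "\<And>q. q \<in> Q \<Longrightarrow> inj (P q)" and T: "\<And>q x. q \<in> Q \<Longrightarrow> T q x \<in> Q"
    and L: "\<And>q x. q \<in> Q \<Longrightarrow> L q x \<in> carrier Aut_T"
    and R: "\<And>q x. q \<in> Q \<Longrightarrow> R q x \<in> carrier Aut_T"
  obtains F where "\<And>q. q \<in> Q \<Longrightarrow> F q \<in> carrier Aut_T"
    and "\<And>q x w. q \<in> Q \<Longrightarrow> F q (x # w) = P q x # R q x (F (T q x) (L q x w))"
proof -
  define F where "F q w = wreath_rec P T L R (length w) q w" for q w
  have F0: "F q [] = []" for q by (simp add: F_def)
  have F: "F q (x # w) = P q x # R q x (F (T q x) (L q x w))" if "q \<in> Q" for q x w
    by (simp add: F_def Aut_T_length[OF L[OF that]])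
  have len: "length (F q w) = length w" if "q \<in> Q" for q w
    using that
  proof (induction "length w" arbitrary: q w)
    case 0
    then show ?case by (simp add: F0)
  next
    case (Suc n)
    then obtain x u where w: "w = x # u" "length u = n" by (metis length_Suc_conv)
    then show ?case
      using Suc.hyps(1)[of "L q x u" "T q x"] Suc.prems L T R by (simp add: F Aut_T_length)
  qed
  have one_letter: "\<exists>y. g (w @ [x]) = g w @ [y]" if "g \<in> carrier Aut_T" for g :: "'x list \<Rightarrow> 'x list" and w x
    using tree_auts_child[of g w x] that by (simp add: Aut_T_def)
  have ext: "\<exists>y. F q (w @ [z]) = F q w @ [y]" if "q \<in> Q" for q w z
    using that
  proof (induction "length w" arbitrary: q w z)
    case 0
    then show ?case using len[of q "[z]"] by (auto simp: F0 length_Suc_conv)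
  next
    case (Suc n)
    then obtain x u where w: "w = x # u" "length u = n" by (metis length_Suc_conv)
    obtain z1 where 1: "L q x (u @ [z]) = L q x u @ [z1]" using one_letter[OF L[OF Suc.prems]] by blast
    have "\<exists>y. F (T q x) (L q x u @ [z1]) = F (T q x) (L q x u) @ [y]"
      using Suc.prems w by (intro Suc.hyps(1)) (simp_all add: L T Aut_T_length)
    then obtain z2 where 2: "F (T q x) (L q x u @ [z1]) = F (T q x) (L q x u) @ [z2]" by blast
    obtain z3 where 3: "R q x (F (T q x) (L q x u) @ [z2]) = R q x (F (T q x) (L q x u)) @ [z3]"
      using one_letter[OF R[OF Suc.prems]] by blast
    show ?case using w Suc.prems by (simp add: F 1 2 3)
  qed
  have inj: "w = w'" if "q \<in> Q" "F q w = F q w'" for q w w'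
    using that
  proof (induction "length w" arbitrary: q w w')
    case 0
    then show ?case using len[of q w'] by (simp add: F0)
  next
    case (Suc n)
    have "length w' = Suc n" using Suc.prems len Suc.hyps(2) by metis
    then obtain x u x' u' where w: "w = x # u" "w' = x' # u'" "length u = n"
      using Suc.hyps(2) by (metis length_Suc_conv)
    have "x = x'" using Suc.prems w P by (auto simp: F dest: injD)
    then have "F (T q x) (L q x u) = F (T q x) (L q x u')"
      using Suc.prems w Aut_T_inject[OF R[OF Suc.prems(1)]] by (simp add: F)
    then have "L q x u = L q x u'"
      using Suc.hyps(1)[of "L q x u" "T q x"] T L Suc.prems w by (simp add: Aut_T_length)
    then show ?case using w \<open>x = x'\<close> Aut_T_inject[OF L[OF Suc.prems(1)]] by simp
  qed
  have "F q \<in> carrier Aut_T" if "q \<in> Q" for q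
    using len[OF that] ext[OF that] injI[of "F q", OF inj[OF that]] by (rule Aut_TI)
  then show ?thesis using F by (rule that)
qed

section \<open>A finite family of conjugators closed under first returns\<close>

text \<open>
  The representative is chosen from the orbit as a set, so all letters of an orbit share it.
\<close>

definition orbit_rep :: "('x list \<Rightarrow> 'x list) \<Rightarrow> 'x \<Rightarrow> 'x" where
  "orbit_rep c x = (SOME r. [r] \<in> Orb c [x])"

definition orbit_index :: "('x list \<Rightarrow> 'x list) \<Rightarrow> 'x \<Rightarrow> nat" where
  "orbit_index c x = (LEAST i. (c ^^ i) [orbit_rep c x] = [x])"

context
  fixes c :: "'x::finite list \<Rightarrow> 'x list"
  assumes c: "c \<in> carrier Aut_T"
begin

lemma funpow_orbit_index: "(c ^^ orbit_index c x) [orbit_rep c x] = [x]"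
proof -
  have "[orbit_rep c x] \<in> Orb c [x]"
    unfolding orbit_rep_def by (rule someI[of "\<lambda>r. [r] \<in> Orb c [x]" x]) (rule Orb_refl[OF c])
  then have "[x] \<in> Orb c [orbit_rep c x]" by (rule Orb_sym[OF c])
  then have "\<exists>i. (c ^^ i) [orbit_rep c x] = [x]" by (auto simp: Orb_eq_range[OF c] dest: sym)
  then show ?thesis unfolding orbit_index_def by (rule LeastI_ex)
qed

lemma orbit_index_le: "(c ^^ i) [orbit_rep c x] = [x] \<Longrightarrow> orbit_index c x \<le> i"
  unfolding orbit_index_def by (rule Least_le)

lemma orbit_index_less: "orbit_index c x < card (Orb c [orbit_rep c x])"
proof (rule ccontr)
  let ?r = "[orbit_rep c x]" and ?i = "orbit_index c x"
  let ?m = "card (Orb c ?r)"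
  assume "\<not> ?i < ?m"
  then have "(c ^^ (?i - ?m)) ((c ^^ ?m) ?r) = [x]"
    using funpow_orbit_index by (simp flip: comp_apply[of "c ^^ (?i - ?m)"] funpow_add)
  then have "?i \<le> ?i - ?m" using orbit_index_le by (simp add: funpow_card_Orb[OF c])
  moreover have "?m > 0" using ex_return[OF c, of ?r] by (auto simp: funpow_fixed_iff_card_Orb_dvd[OF c])
  ultimately show False using \<open>\<not> ?i < ?m\<close> by simp
qed

lemma orbit_rep_step: "c [x] = [y] \<Longrightarrow> orbit_rep c y = orbit_rep c x"
  using Orb_step[OF c, of "[x]"] by (simp add: orbit_rep_def)

lemma orbit_index_step:
  assumes y: "c [x] = [y]" and "y \<noteq> orbit_rep c x"
  shows "orbit_index c y = Suc (orbit_index c x)"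
proof (rule antisym)
  have rep: "orbit_rep c y = orbit_rep c x" by (rule orbit_rep_step[OF y])
  show "orbit_index c y \<le> Suc (orbit_index c x)"
    by (rule orbit_index_le) (simp add: rep funpow_orbit_index y)
  have eq: "(c ^^ orbit_index c y) [orbit_rep c x] = [y]"
    using funpow_orbit_index[of y] by (simp add: rep)
  then obtain j where j: "orbit_index c y = Suc j"
    using assms(2) by (cases "orbit_index c y") auto
  then have "c ((c ^^ j) [orbit_rep c x]) = c [x]" using eq y by simp
  then have "(c ^^ j) [orbit_rep c x] = [x]" using Aut_T_inject[OF c] by blast
  then show "Suc (orbit_index c x) \<le> orbit_index c y" using orbit_index_le j by simp
qed

text \<open>The letter that \<open>c\<close> sends back to the representative is the last of its orbit.\<close>

lemma orbit_index_return:
  assumes y: "c [x] = [orbit_rep c x]"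
  shows "orbit_index c (orbit_rep c x) = 0" "Suc (orbit_index c x) = card (Orb c [orbit_rep c x])"
proof -
  have "orbit_index c (orbit_rep c x) \<le> 0"
    by (rule orbit_index_le) (simp add: orbit_rep_step[OF y])
  then show "orbit_index c (orbit_rep c x) = 0" by simp
  have "(c ^^ Suc (orbit_index c x)) [orbit_rep c x] = [orbit_rep c x]"
    by (simp add: funpow_orbit_index y)
  then have "card (Orb c [orbit_rep c x]) dvd Suc (orbit_index c x)"
    by (simp only: funpow_fixed_iff_card_Orb_dvd[OF c])
  then show "Suc (orbit_index c x) = card (Orb c [orbit_rep c x])"
    using orbit_index_less[of x] by (intro antisym) (auto dest: dvd_imp_le)
qed

end

text \<open>
  The factors that link the state of a conjugator at an orbit representative to its states at the
  other letters of the orbit.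
\<close>

definition transit_states :: "('x list \<Rightarrow> 'x list) \<Rightarrow> ('x list \<Rightarrow> 'x list) set" where
  "transit_states c = {state (c ^^ i) [r] | i r. i < card (Orb c [r])}"

lemma finite_transit_states: "finite (transit_states (c :: 'x::finite list \<Rightarrow> 'x list))"
proof -
  have "transit_states c = (\<Union>r. (\<lambda>i. state (c ^^ i) [r]) ` {..<card (Orb c [r])})"
    by (auto simp: transit_states_def)
  then show ?thesis by simp
qed

text \<open>
  The arbitrary conjugators \<open>k (c, d)\<close> only supply the action on the first level and the proof
  that first returns are again conjugate; the states below the first level are replaced by the
  members of the family. That \<open>F (c, d)\<close> intertwines \<open>c\<close> and \<open>d\<close> rests on the identity called
  \<open>transport\<close> in the proof: writing a word as the image of some \<open>r # z\<close> under \<open>c\<^sup>i\<close>, its image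
  under \<open>F (c, d)\<close> is obtained by applying the next member of the family to \<open>z\<close> and then \<open>d\<^sup>i\<close>.
  Applying \<open>c\<close> increases \<open>i\<close> by one, except at the end of the orbit, where \<open>c\<^sup>m\<close> acts on \<open>z\<close> as
  the first return, and the claim follows from the same claim for the shorter word \<open>z\<close>.
\<close>

proposition compatible_conjugators:
  fixes C D :: "('x::finite list \<Rightarrow> 'x list) set"
  assumes C: "C \<subseteq> carrier Aut_T" "\<And>c r. c \<in> C \<Longrightarrow> return_state c [r] \<in> C"
    and D: "D \<subseteq> carrier Aut_T" "\<And>d r. d \<in> D \<Longrightarrow> return_state d [r] \<in> D"
  defines "Q \<equiv> {(c, d). c \<in> C \<and> d \<in> D \<and> (\<exists>k. conjugator c d k)}"
  obtains F where "\<And>c d. (c, d) \<in> Q \<Longrightarrow> conjugator c d (F (c, d))"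
    and "\<And>c d x. (c, d) \<in> Q \<Longrightarrow> \<exists>l\<in>transit_states c. \<exists>q\<in>Q. \<exists>r\<in>transit_states d.
      state (F (c, d)) [x] = inv\<^bsub>Aut_T\<^esub> l \<otimes>\<^bsub>Aut_T\<^esub> F q \<otimes>\<^bsub>Aut_T\<^esub> r"
proof -
  interpret group "Aut_T :: ('x list \<Rightarrow> 'x list) monoid" by (rule group_Aut_T)
  define k where "k q = (SOME k. conjugator (fst q) (snd q) k)"
    for q :: "('x list \<Rightarrow> 'x list) \<times> ('x list \<Rightarrow> 'x list)"
  have k: "conjugator c d (k (c, d))" if "(c, d) \<in> Q" for c d
    using that someI_ex[of "conjugator c d"] by (auto simp: Q_def k_def)
  have Q: "c \<in> C" "d \<in> D" "c \<in> carrier Aut_T" "d \<in> carrier Aut_T" if "(c, d) \<in> Q" for c d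
    using that C(1) D(1) by (auto simp: Q_def)
  define P where "P q x = hd (k q [x])" for q x
  have P: "k q [x] = [P q x]" if "q \<in> Q" for q x
  proof -
    have "k q \<in> carrier Aut_T" using k[of "fst q" "snd q"] that by (simp add: conjugator_def)
    then show ?thesis using Aut_T_length[of "k q" "[x]"] by (auto simp: P_def length_Suc_conv)
  qed
  define T where "T = (\<lambda>(c, d) x. (return_state c [orbit_rep c x],
      return_state d [P (c, d) (orbit_rep c x)]))"
  define L where "L = (\<lambda>(c :: 'x list \<Rightarrow> 'x list, d :: 'x list \<Rightarrow> 'x list) x.
      inv\<^bsub>Aut_T\<^esub> (state (c ^^ orbit_index c x) [orbit_rep c x]))"
  define R where "R = (\<lambda>(c, d) x.
      state (d ^^ orbit_index c x) [P (c, d) (orbit_rep c x)])"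
  have TQ: "T q x \<in> Q" if q: "q \<in> Q" for q x
  proof -
    obtain c d where cd: "q = (c, d)" by (cases q)
    then have q': "(c, d) \<in> Q" using q by simp
    let ?r = "orbit_rep c x"
    have "conjugator (return_state c [?r]) (return_state d [P (c, d) ?r]) (state (k (c, d)) [?r])"
      using conjugator_return_state[OF Q(3,4)[OF q'] k[OF q'], of "[?r]"] by (simp only: P[OF q'])
    moreover have "T q x = (return_state c [?r], return_state d [P (c, d) ?r])"
      by (simp add: cd T_def)
    ultimately show ?thesis using C(2)[OF Q(1)[OF q']] D(2)[OF Q(2)[OF q']]
      by (auto simp: Q_def)
  qed
  have Pinj: "inj (P q)" if q: "q \<in> Q" for q
  proof (rule injI)
    fix x y assume "P q x = P q y"
    then have "k q [x] = k q [y]" by (simp add: P[OF q])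
    then show "x = y"
      using k[of "fst q" "snd q"] q Aut_T_inject[of "k q"] by (simp add: conjugator_def)
  qed
  have LA: "L q x \<in> carrier Aut_T" and RA: "R q x \<in> carrier Aut_T" if "q \<in> Q" for q x
    using that Q(3,4)[of "fst q" "snd q"]
    by (simp_all add: L_def R_def split_beta state_in_Aut_T funpow_Aut_T)
  obtain F where FA: "\<And>q. q \<in> Q \<Longrightarrow> F q \<in> carrier Aut_T"
    and F: "\<And>q x w. q \<in> Q \<Longrightarrow> F q (x # w) = P q x # R q x (F (T q x) (L q x w))"
    using wreath_recursion[where P = P and T = T and L = L and R = R and Q = Q, OF Pinj TQ LA RA]
    by blast
  have transport: "F (c, d) (x # u) = (d ^^ i) (P (c, d) r # F (T (c, d) x) z)"
    if q: "(c, d) \<in> Q" and z: "(c ^^ i) (r # z) = x # u"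
      and ir: "i = orbit_index c x" "r = orbit_rep c x" for c d x u z i r
  proof -
    have cA: "c ^^ i \<in> carrier Aut_T" and dA: "d ^^ i \<in> carrier Aut_T" 
      using Q[OF q] by (simp_all add: funpow_Aut_T)
    have ri: "(c ^^ i) [r] = [x]" using funpow_orbit_index Q[OF q] ir by simp
    have "[P (c, d) x] = k (c, d) ((c ^^ i) [r])" by (simp add: P[OF q] ri)
    also have "\<dots> = (d ^^ i) (k (c, d) [r])"
      using k[OF q] by (intro funpow_conjugate) (simp add: conjugator_def)
    finally have y: "(d ^^ i) [P (c, d) r] = [P (c, d) x]" by (simp add: P[OF q])
    have "state (c ^^ i) [r] z = u" using state_append[OF cA, of "[r]" z] z ri by simp
    then have "L (c, d) x u = z"
      using inv_Aut_T_apply(2)[OF state_in_Aut_T[OF cA, of "[r]"], of z] by (simp add: L_def ir)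
    then show ?thesis
      using F[OF q, of x u] state_append[OF dA, of "[P (c, d) r]" "F (T (c, d) x) z"] y
      by (simp add: R_def ir)
  qed
  have conj: "F (c, d) (c w) = d (F (c, d) w)" if "(c, d) \<in> Q" for c d w
    using that
  proof (induction "length w" arbitrary: c d w)
    case 0
    then show ?case
      using Q[OF 0(2)] FA[OF 0(2)] Aut_T_length[of _ "[]"] by (metis length_0_conv)
  next
    case (Suc n)
    note q = \<open>(c, d) \<in> Q\<close>
    note cA = Q(3)[OF q] and dA = Q(4)[OF q]
    obtain x u where w: "w = x # u" "length u = n" using Suc.hyps(2) by (metis length_Suc_conv)
    let ?i = "orbit_index c x" and ?r = "orbit_rep c x"
    let ?y = "P (c, d) ?r" and ?T = "T (c, d) x"
    define z where "z = (inv\<^bsub>Aut_T\<^esub> (state (c ^^ ?i) [?r])) u"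
    have iA: "c ^^ ?i \<in> carrier Aut_T" by (rule funpow_Aut_T[OF cA])
    have z: "(c ^^ ?i) (?r # z) = x # u"
      using state_append[OF iA, of "[?r]" z] funpow_orbit_index[OF cA, of x]
        inv_Aut_T_apply(1)[OF state_in_Aut_T[OF iA, of "[?r]"], of u] by (simp add: z_def)
    have zlen: "length z = n" using arg_cong[OF z, of length] w(2) Aut_T_length[OF iA] by simp
    have dw: "d (F (c, d) w) = (d ^^ Suc ?i) (?y # F ?T z)"
      using transport[OF q z] w by simp
    have cz: "c w = (c ^^ Suc ?i) (?r # z)" using z w by simp
    obtain y where y: "c [x] = [y]"
      using Aut_T_length[OF cA, of "[x]"] by (auto simp: length_Suc_conv)
    have cw: "c w = y # state c [x] u" using state_append[OF cA, of "[x]" u] w y by simp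
    have Ty: "T (c, d) y = ?T" by (simp add: T_def orbit_rep_step[OF cA y])
    show ?case
    proof (cases "y = ?r")
      case False
      then show ?thesis
        using transport[OF q, of "Suc ?i" ?r z y "state c [x] u"] cz cw dw Ty
          orbit_index_step[OF cA y] orbit_rep_step[OF cA y] by metis
    next
      case True
      let ?c = "return_state c [?r]" and ?d = "return_state d [?y]"
      have m: "Suc ?i = card (Orb c [?r])" and i0: "orbit_index c ?r = 0"
        using orbit_index_return[OF cA] y True by auto
      have "card (Orb d (k (c, d) [?r])) = card (Orb c [?r])"
        by (rule conjugator_card_Orb[OF cA dA k[OF q]])
      then have md: "Suc ?i = card (Orb d [?y])" using m by (simp add: P[OF q])
      have T: "?T = (?c, ?d)" by (simp add: T_def)
      have "c w = ?r # ?c z" using funpow_return_state[OF cA, of 1 "[?r]" z] cz m by simp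
      then have "F (c, d) (c w) = ?y # F ?T (?c z)"
        using transport[OF q, of 0 ?r "?c z" ?r "?c z"] i0 orbit_rep_step[OF cA y] True Ty by simp
      also have "\<dots> = ?y # ?d (F ?T z)"
        using Suc.hyps(1)[of z ?c ?d] zlen TQ[OF q, of x] T by simp
      also have "\<dots> = (d ^^ Suc ?i) (?y # F ?T z)"
        using funpow_return_state[OF dA, of 1 "[?y]" "F ?T z"] md by simp
      finally show ?thesis by (simp only: dw)
    qed
  qed
  show ?thesis
  proof
    show "conjugator c d (F (c, d))" if "(c, d) \<in> Q" for c d
      using FA[OF that] conj[OF that] by (simp add: conjugator_def)
    fix c d x assume q: "(c, d) \<in> Q"
    note cA = Q(3)[OF q] and dA = Q(4)[OF q]
    let ?i = "orbit_index c x" and ?r = "orbit_rep c x"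
    let ?y = "P (c, d) ?r"
    have "state (F (c, d)) [x] = L (c, d) x \<otimes>\<^bsub>Aut_T\<^esub> F (T (c, d) x) \<otimes>\<^bsub>Aut_T\<^esub> R (c, d) x"
    proof (rule state_eqI[OF FA[OF q]])
      fix w
      have "F (c, d) [x] = [P (c, d) x]"
        using Aut_T_length[OF FA[OF q], of "[x]"] F[OF q, of x "[]"] by simp
      then show "F (c, d) ([x] @ w) = F (c, d) [x]
          @ (L (c, d) x \<otimes>\<^bsub>Aut_T\<^esub> F (T (c, d) x) \<otimes>\<^bsub>Aut_T\<^esub> R (c, d) x) w"
        by (simp add: F[OF q] mult_Aut_T_apply)
    qed
    moreover have "state (c ^^ ?i) [?r] \<in> transit_states c"
      using orbit_index_less[OF cA] unfolding transit_states_def by blast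
    moreover have "?i < card (Orb d [?y])"
      using orbit_index_less[OF cA, of x] conjugator_card_Orb[OF cA dA k[OF q], of "[?r]"]
      by (simp add: P[OF q])
    then have "R (c, d) x \<in> transit_states d" unfolding transit_states_def R_def by auto
    ultimately show "\<exists>l\<in>transit_states c. \<exists>q\<in>Q. \<exists>r\<in>transit_states d.
      state (F (c, d)) [x] = inv\<^bsub>Aut_T\<^esub> l \<otimes>\<^bsub>Aut_T\<^esub> F q \<otimes>\<^bsub>Aut_T\<^esub> r"
      using TQ[OF q, of x] by (auto simp: L_def)
  qed
qed

section \<open>Finite-state conjugators\<close>

lemma finite_transit_closure:
  fixes a :: "'x::finite list \<Rightarrow> 'x list"
  assumes a: "contracting_aut a" and fin: "finite (orbit_signalizer a)"
  obtains K where "finite K" "K \<subseteq> carrier Aut_T" "\<one>\<^bsub>Aut_T\<^esub> \<in> K"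
    "\<And>c p l x. c \<in> orbit_signalizer a \<Longrightarrow> p \<in> K \<Longrightarrow> l \<in> transit_states c
      \<Longrightarrow> l \<otimes>\<^bsub>Aut_T\<^esub> state p [x] \<in> K"
proof -
  let ?G = "generate Aut_T (states a)"
  have aA: "a \<in> carrier Aut_T" and G: "contracting_group ?G"
    using a by (auto simp: contracting_aut_def)
  then have sub: "subgroup ?G Aut_T" and ss: "\<And>g v. g \<in> ?G \<Longrightarrow> state g v \<in> ?G"
    by (auto simp: contracting_group_def self_similar_def)
  have pow: "g ^^ n \<in> ?G" if "g \<in> ?G" for g n
  proof (induction n)
    case 0
    then show ?case using subgroup.one_closed[OF sub] by (simp add: Aut_T_def id_def)
  next
    case (Suc n)
    have "g ^^ Suc n = g ^^ n \<otimes>\<^bsub>Aut_T\<^esub> g" by (simp add: fun_eq_iff mult_Aut_T_apply)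
    then show ?case using subgroup.m_closed[OF sub Suc that] by simp
  qed
  have "a \<in> ?G" using self_in_states[OF aA] by (rule generate.incl)
  then have "orbit_signalizer a \<subseteq> ?G"
    using ss pow by (auto simp: orbit_signalizer_eq return_state_def)
  then have "\<Union> (transit_states ` orbit_signalizer a) \<subseteq> ?G"
    using ss pow by (auto simp: transit_states_def)
  moreover have "finite (\<Union> (transit_states ` orbit_signalizer a))"
    using fin finite_transit_states by blast
  ultimately obtain K where "finite K" "K \<subseteq> carrier Aut_T" "\<one>\<^bsub>Aut_T\<^esub> \<in> K"
    "\<And>p l x. p \<in> K \<Longrightarrow> l \<in> \<Union> (transit_states ` orbit_signalizer a)
      \<Longrightarrow> l \<otimes>\<^bsub>Aut_T\<^esub> state p [x] \<in> K"
    using contracting_group_finite_closure[OF G] by metis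
  then show ?thesis by (intro that[of K]) blast+
qed

text \<open>
  The conjugator is the member of the compatible family at \<open>(a, b)\<close>. Descending from a word to its
  next letter keeps the form \<open>p\<^sup>-\<^sup>1 F q s\<close> of a state; as the left factor is inverted, both \<open>p\<close> and
  \<open>s\<close> grow by a new factor on the left, so the same closure lemma confines them to finite sets.
\<close>

theorem finite_state_conjugator:
  fixes a b :: "'x::finite list \<Rightarrow> 'x list"
  assumes a: "contracting_aut a" and b: "contracting_aut b"
    and fin: "finite (orbit_signalizer a)" "finite (orbit_signalizer b)"
    and k: "conjugator a b k"
  obtains h where "conjugator a b h" "finite (states h)"
proof -
  interpret group "Aut_T :: ('x list \<Rightarrow> 'x list) monoid" by (rule group_Aut_T)
  have OS: "orbit_signalizer g \<subseteq> carrier Aut_T" "\<And>c r. c \<in> orbit_signalizer g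
      \<Longrightarrow> return_state c [r] \<in> orbit_signalizer g" "g \<in> orbit_signalizer g"
    if "contracting_aut g" for g :: "'x list \<Rightarrow> 'x list"
  proof -
    have g: "g \<in> carrier Aut_T" using that by (simp add: contracting_aut_def)
    show "orbit_signalizer g \<subseteq> carrier Aut_T"
      using return_state_Aut_T[OF g] by (auto simp: orbit_signalizer_eq)
    show "return_state c [r] \<in> orbit_signalizer g" if "c \<in> orbit_signalizer g" for c r
      using that return_state_append[OF g] by (auto simp: orbit_signalizer_eq)
    (* the root is a fixed point, so g is its own first return there *)
    have "g = return_state g []"
    proof -
      have "(g ^^ n) [] = []" for n using Aut_T_length[OF funpow_Aut_T[OF g], of n "[]"] by simp
      then have "Orb g [] = {[]}" by (auto simp: Orb_eq_range[OF g])
      then show ?thesis by (simp add: return_state_def state_Nil[OF g])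
    qed
    then show "g \<in> orbit_signalizer g" unfolding orbit_signalizer_eq by blast
  qed
  let ?Q = "{(c, d). c \<in> orbit_signalizer a \<and> d \<in> orbit_signalizer b \<and> (\<exists>k. conjugator c d k)}"
  obtain F where F: "\<And>c d. (c, d) \<in> ?Q \<Longrightarrow> conjugator c d (F (c, d))"
    and stF: "\<And>c d x. (c, d) \<in> ?Q \<Longrightarrow> \<exists>l\<in>transit_states c. \<exists>q\<in>?Q. \<exists>r\<in>transit_states d.
      state (F (c, d)) [x] = inv\<^bsub>Aut_T\<^esub> l \<otimes>\<^bsub>Aut_T\<^esub> F q \<otimes>\<^bsub>Aut_T\<^esub> r"
    using compatible_conjugators[OF OS(1,2)[OF a] OS(1,2)[OF b]] by blast
  have FA: "F q \<in> carrier Aut_T" if "q \<in> ?Q" for q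
    using F[of "fst q" "snd q"] that by (auto simp: conjugator_def)
  have tA: "transit_states c \<subseteq> carrier Aut_T" if "c \<in> carrier Aut_T" for c :: "'x list \<Rightarrow> 'x list"
    using that by (auto simp: transit_states_def intro!: state_in_Aut_T funpow_Aut_T)
  obtain K where K: "finite K" "K \<subseteq> carrier Aut_T" "\<one>\<^bsub>Aut_T\<^esub> \<in> K"
    "\<And>c p l x. c \<in> orbit_signalizer a \<Longrightarrow> p \<in> K \<Longrightarrow> l \<in> transit_states c
      \<Longrightarrow> l \<otimes>\<^bsub>Aut_T\<^esub> state p [x] \<in> K"
    using finite_transit_closure[OF a fin(1)] by blast
  obtain K' where K': "finite K'" "K' \<subseteq> carrier Aut_T" "\<one>\<^bsub>Aut_T\<^esub> \<in> K'"
    "\<And>c p l x. c \<in> orbit_signalizer b \<Longrightarrow> p \<in> K' \<Longrightarrow> l \<in> transit_states c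
      \<Longrightarrow> l \<otimes>\<^bsub>Aut_T\<^esub> state p [x] \<in> K'"
    using finite_transit_closure[OF b fin(2)] by blast
  let ?h = "F (a, b)"
  have ab: "(a, b) \<in> ?Q" using OS(3) a b k by blast
  have st: "\<exists>p\<in>K. \<exists>q\<in>?Q. \<exists>s\<in>K'. state ?h v = inv\<^bsub>Aut_T\<^esub> p \<otimes>\<^bsub>Aut_T\<^esub> F q \<otimes>\<^bsub>Aut_T\<^esub> s" for v
  proof (induction v rule: rev_induct)
    case Nil
    show ?case
      using K(3) K'(3) ab FA[OF ab]
      by (intro bexI[of _ "\<one>\<^bsub>Aut_T\<^esub>"] bexI[of _ "(a, b)"]) (simp_all add: state_Nil)
  next
    case (snoc x v)
    then obtain p c d s where q: "p \<in> K" "(c, d) \<in> ?Q" "s \<in> K'"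
      and sv: "state ?h v = inv\<^bsub>Aut_T\<^esub> p \<otimes>\<^bsub>Aut_T\<^esub> F (c, d) \<otimes>\<^bsub>Aut_T\<^esub> s" by blast
    have pA: "p \<in> carrier Aut_T" and sA: "s \<in> carrier Aut_T" and fA: "F (c, d) \<in> carrier Aut_T"
      using q K(2) K'(2) FA by blast+
    obtain y where y: "(inv\<^bsub>Aut_T\<^esub> p) [x] = [y]"
      using Aut_T_length[OF inv_closed[OF pA], of "[x]"] by (auto simp: length_Suc_conv)
    obtain z where z: "F (c, d) [y] = [z]"
      using Aut_T_length[OF fA, of "[y]"] by (auto simp: length_Suc_conv)
    obtain l q' r where l: "l \<in> transit_states c" "q' \<in> ?Q" "r \<in> transit_states d"
      "state (F (c, d)) [y] = inv\<^bsub>Aut_T\<^esub> l \<otimes>\<^bsub>Aut_T\<^esub> F q' \<otimes>\<^bsub>Aut_T\<^esub> r"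
      using stF[OF q(2), of y] by blast
    have cdA: "c \<in> carrier Aut_T" "d \<in> carrier Aut_T" using q(2) OS(1) a b by blast+
    have A: "l \<in> carrier Aut_T" "r \<in> carrier Aut_T" "F q' \<in> carrier Aut_T"
      "state p [y] \<in> carrier Aut_T" "state s [z] \<in> carrier Aut_T"
      using l tA cdA FA[OF l(2)] state_in_Aut_T[OF pA] state_in_Aut_T[OF sA] by blast+
    have "state ?h (v @ [x]) = state (state ?h v) [x]" by (simp add: state_state[OF FA[OF ab]])
    also have "\<dots> = inv\<^bsub>Aut_T\<^esub> (state p [y]) \<otimes>\<^bsub>Aut_T\<^esub> state (F (c, d)) [y] \<otimes>\<^bsub>Aut_T\<^esub> state s [z]"
      by (simp add: sv state_mult state_inv pA sA fA y z mult_Aut_T_apply)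
    also have "\<dots> = inv\<^bsub>Aut_T\<^esub> (l \<otimes>\<^bsub>Aut_T\<^esub> state p [y]) \<otimes>\<^bsub>Aut_T\<^esub> F q' \<otimes>\<^bsub>Aut_T\<^esub> (r \<otimes>\<^bsub>Aut_T\<^esub> state s [z])"
      using A by (simp add: l(4) inv_mult_group m_assoc)
    finally show ?case
      using K(4)[OF _ q(1) l(1), of y] K'(4)[OF _ q(3) l(3), of z] q(2) l(2) by blast
  qed
  have "states ?h \<subseteq> (\<lambda>(p, q, s). inv\<^bsub>Aut_T\<^esub> p \<otimes>\<^bsub>Aut_T\<^esub> F q \<otimes>\<^bsub>Aut_T\<^esub> s) ` (K \<times> ?Q \<times> K')"
  proof
    fix g assume "g \<in> states ?h"
    then obtain v where "g = state ?h v" by (auto simp: states_def)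
    then show "g \<in> (\<lambda>(p, q, s). inv\<^bsub>Aut_T\<^esub> p \<otimes>\<^bsub>Aut_T\<^esub> F q \<otimes>\<^bsub>Aut_T\<^esub> s) ` (K \<times> ?Q \<times> K')"
      using st[of v] by (force simp: image_iff)
  qed
  moreover have "finite ?Q"
    by (rule finite_subset[of _ "orbit_signalizer a \<times> orbit_signalizer b"]) (use fin in auto)
  ultimately have "finite (states ?h)" using K(1) K'(1) by (auto intro: finite_subset)
  then show ?thesis using F[OF ab] by (intro that)
qed

lemma contracting_aut_FAut_T:
  fixes a :: "'x::finite list \<Rightarrow> 'x list"
  assumes "contracting_aut a"
  shows "a \<in> carrier FAut_T"
proof -
  have a: "a \<in> carrier Aut_T" and G: "contracting_group (generate Aut_T (states a))"
    using assms by (auto simp: contracting_aut_def)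
  have "a \<in> generate Aut_T (states a)" using self_in_states[OF a] by (rule generate.incl)
  then show ?thesis using contracting_group_finite_states[OF G] a by (simp add: FAut_T_def)
qed

theorem theorem3:
  fixes a b :: "'x::finite list \<Rightarrow> 'x list"
  assumes "contracting_aut a" and "contracting_aut b"
    and "finite (orbit_signalizer a)" and "finite (orbit_signalizer b)"
  shows "conjugate_in Aut_T a b \<longleftrightarrow> conjugate_in FAut_T a b"
proof -
  have a: "a \<in> carrier Aut_T" and b: "b \<in> carrier Aut_T"
    using assms(1,2) by (auto simp: contracting_aut_def)
  have F: "h \<in> carrier Aut_T" "b = inv\<^bsub>FAut_T\<^esub> h \<otimes>\<^bsub>FAut_T\<^esub> a \<otimes>\<^bsub>FAut_T\<^esub> h
      \<longleftrightarrow> conjugator a b h" if "h \<in> carrier FAut_T" for h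
  proof -
    show h: "h \<in> carrier Aut_T" using that by (simp add: FAut_T_def)
    have "inv\<^bsub>FAut_T\<^esub> h = inv\<^bsub>Aut_T\<^esub> h"
      using group.m_inv_consistent[OF group_Aut_T subgroup_FAut_T that] by (simp add: FAut_T_def)
    then show "b = inv\<^bsub>FAut_T\<^esub> h \<otimes>\<^bsub>FAut_T\<^esub> a \<otimes>\<^bsub>FAut_T\<^esub> h \<longleftrightarrow> conjugator a b h"
      by (simp add: conjugator_iff[OF a b h] FAut_T_def)
  qed
  show ?thesis
  proof
    assume "conjugate_in Aut_T a b"
    then obtain k where "conjugator a b k"
      using conjugator_iff[OF a b] by (auto simp: conjugate_in_def)
    then obtain h where h: "conjugator a b h" "finite (states h)"
      using finite_state_conjugator[OF assms] by blast
    then have "h \<in> carrier FAut_T" by (simp add: FAut_T_def conjugator_def)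
    then show "conjugate_in FAut_T a b"
      using F h(1) contracting_aut_FAut_T assms(1,2) by (auto simp: conjugate_in_def)
  next
    assume "conjugate_in FAut_T a b"
    then obtain h where "h \<in> carrier FAut_T" "conjugator a b h"
      using F by (auto simp: conjugate_in_def)
    then show "conjugate_in Aut_T a b"
      using F(1) conjugator_iff[OF a b] a b by (auto simp: conjugate_in_def)
  qed
qed

end
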